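(* Let $V:L^2[0,1]\to L^2[0,1]$ be the Volterra operator. If $n\ge 2$ is an integer, then \[ \|(I+\lambda V^n)(I+\mu V^n)^{-1}\|>1 \] for all $\lambda,\mu\in\mathbb{C}$ with $\lambda\ne\mu$.
   Context: $L^2[0,1]$ is the complex Hilbert space of (classes of) square-integrable complex-valued functions on $[0,1]$ with respect to Lebesgue measure. The Volterra operator is the bounded operator defined by $Vf(x):=\int_0^x f(t)\,dt$ for $f\in L^2[0,1]$. $I$ is the identity operator on $L^2[0,1]$, and $\|\cdot\|$ is the operator norm. The spectrum of $V$ is $\{0\}$, so $I+\mu V^n$ is invertible for every $\mu\in\mathbb{C}$ and $n\ge1$. *)

theory Defs
  imports "HOL-Analysis.Analysis"
begin

abbreviation lebesgue_unit :: "real measure" where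
  "lebesgue_unit \<equiv> lebesgue_on {0..1}"

definition square_integrable :: "(real \<Rightarrow> complex) \<Rightarrow> bool" where
  "square_integrable f \<longleftrightarrow>
     f \<in> borel_measurable lebesgue_unit \<and> integrable lebesgue_unit (\<lambda>x. (cmod (f x))\<^sup>2)"

definition ae_eq_unit :: "(real \<Rightarrow> complex) \<Rightarrow> (real \<Rightarrow> complex) \<Rightarrow> bool" where
  "ae_eq_unit f g \<longleftrightarrow>
     square_integrable f \<and> square_integrable g \<and> (AE x in lebesgue_unit. f x = g x)"

lemma square_integrable_measurable [measurable_dest]:
  "square_integrable f \<Longrightarrow> f \<in> borel_measurable lebesgue_unit"
  by (simp add: square_integrable_def)

lemma borel_measurable_cnj [measurable (raw)]:
  "f \<in> borel_measurable M \<Longrightarrow> (\<lambda>x. cnj (f x)) \<in> borel_measurable M"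
  by (rule borel_measurable_continuous_on[of cnj]) (auto intro: continuous_intros)

lemma square_integrable_norm_square:
  "square_integrable f \<Longrightarrow> integrable lebesgue_unit (\<lambda>x. (cmod (f x))\<^sup>2)"
  by (simp add: square_integrable_def)

lemma square_integrable_zero: "square_integrable (\<lambda>x. 0)"
  by (simp add: square_integrable_def)

lemma square_integrable_add:
  assumes [measurable]: "square_integrable f" "square_integrable g"
  shows "square_integrable (\<lambda>x. f x + g x)"
proof -
  have "integrable lebesgue_unit (\<lambda>x. (cmod (f x + g x))\<^sup>2)"
  proof (rule Bochner_Integration.integrable_bound)
    show "integrable lebesgue_unit (\<lambda>x. 2 * (cmod (f x))\<^sup>2 + 2 * (cmod (g x))\<^sup>2)"
      using assms by (simp add: square_integrable_def)
    have "(cmod (f x + g x))\<^sup>2 \<le> 2 * (cmod (f x))\<^sup>2 + 2 * (cmod (g x))\<^sup>2" for x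
    proof -
      have "(cmod (f x + g x))\<^sup>2 \<le> (cmod (f x) + cmod (g x))\<^sup>2"
        by (intro power_mono norm_triangle_ineq) simp
      also have "\<dots> \<le> 2 * (cmod (f x))\<^sup>2 + 2 * (cmod (g x))\<^sup>2"
        using sum_squares_bound[of "cmod (f x)" "cmod (g x)"] by (simp add: power2_sum)
      finally show ?thesis .
    qed
    then show "AE x in lebesgue_unit. norm ((cmod (f x + g x))\<^sup>2)
        \<le> norm (2 * (cmod (f x))\<^sup>2 + 2 * (cmod (g x))\<^sup>2)"
      by simp
  qed measurable
  then show ?thesis
    by (simp add: square_integrable_def assms(1,2)[THEN square_integrable_measurable] borel_measurable_add)
qed

lemma square_integrable_cmult:
  assumes [measurable]: "square_integrable f"
  shows "square_integrable (\<lambda>x. c * f x)"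
  using assms by (auto simp: square_integrable_def norm_mult power_mult_distrib)

lemma square_integrable_uminus: "square_integrable f \<Longrightarrow> square_integrable (\<lambda>x. - f x)"
  using square_integrable_cmult[of f "-1"] by simp

lemma square_integrable_diff:
  "square_integrable f \<Longrightarrow> square_integrable g \<Longrightarrow> square_integrable (\<lambda>x. f x - g x)"
  using square_integrable_add[of f "\<lambda>x. - g x"] by (simp add: square_integrable_uminus)

lemma square_integrable_inner:
  assumes [measurable]: "square_integrable f" "square_integrable g"
  shows "integrable lebesgue_unit (\<lambda>x. f x * cnj (g x))"
proof (rule Bochner_Integration.integrable_bound)
  show "integrable lebesgue_unit (\<lambda>x. (cmod (f x))\<^sup>2 + (cmod (g x))\<^sup>2)"
    using assms by (simp add: square_integrable_def)
  have "cmod (f x) * cmod (g x) \<le> (cmod (f x))\<^sup>2 + (cmod (g x))\<^sup>2" for x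
    using sum_squares_bound[of "cmod (f x)" "cmod (g x)"]
      mult_nonneg_nonneg[OF norm_ge_zero norm_ge_zero, of "f x" "g x"] by linarith
  then show "AE x in lebesgue_unit. norm (f x * cnj (g x)) \<le> norm ((cmod (f x))\<^sup>2 + (cmod (g x))\<^sup>2)"
    by (simp add: norm_mult)
qed measurable

lemma square_integrable_integrable:
  assumes "square_integrable f"
  shows "integrable lebesgue_unit f"
proof -
  have "square_integrable (\<lambda>x. 1)"
    by (simp add: square_integrable_def)
  from square_integrable_inner[OF assms this] show ?thesis by simp
qed

text \<open>The space of classes of square-integrable functions under almost-everywhere equality.\<close>

quotient_type L2 = "real \<Rightarrow> complex" / partial: ae_eq_unit
proof (rule part_equivpI)
  show "\<exists>f. ae_eq_unit f f"
    using square_integrable_zero by (auto simp: ae_eq_unit_def)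
  show "symp ae_eq_unit"
    by (auto simp: symp_def ae_eq_unit_def eq_commute)
  show "transp ae_eq_unit"
    unfolding transp_def ae_eq_unit_def by (auto elim: AE_mp)
qed

instantiation L2 :: real_vector
begin

lift_definition zero_L2 :: L2 is "\<lambda>x. 0"
  by (simp add: ae_eq_unit_def square_integrable_zero)

lift_definition plus_L2 :: "L2 \<Rightarrow> L2 \<Rightarrow> L2" is "\<lambda>f g x. f x + g x"
  by (auto simp: ae_eq_unit_def square_integrable_add)

lift_definition minus_L2 :: "L2 \<Rightarrow> L2 \<Rightarrow> L2" is "\<lambda>f g x. f x - g x"
  by (auto simp: ae_eq_unit_def square_integrable_diff)

lift_definition uminus_L2 :: "L2 \<Rightarrow> L2" is "\<lambda>f x. - f x"
  by (auto simp: ae_eq_unit_def square_integrable_uminus)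

lift_definition scaleR_L2 :: "real \<Rightarrow> L2 \<Rightarrow> L2" is "\<lambda>r f x. complex_of_real r * f x"
  by (auto simp: ae_eq_unit_def square_integrable_cmult)

instance
proof
  fix f g h :: L2 and a b :: real
  show "f + g + h = f + (g + h)"
    by transfer (auto simp: ae_eq_unit_def add.assoc intro!: square_integrable_add)
  show "f + g = g + f"
    by transfer (auto simp: ae_eq_unit_def add.commute intro!: square_integrable_add)
  show "0 + f = f"
    by transfer (auto simp: ae_eq_unit_def)
  show "- f + f = 0"
    by transfer (auto simp: ae_eq_unit_def square_integrable_zero)
  show "f - g = f + - g"
    by transfer (auto simp: ae_eq_unit_def intro: square_integrable_diff)
  show "a *\<^sub>R (f + g) = a *\<^sub>R f + a *\<^sub>R g"
    by transfer
      (auto simp: ae_eq_unit_def distrib_left distrib_right intro!: square_integrable_add square_integrable_cmult)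
  show "(a + b) *\<^sub>R f = a *\<^sub>R f + b *\<^sub>R f"
    by transfer
      (auto simp: ae_eq_unit_def distrib_left distrib_right intro!: square_integrable_add square_integrable_cmult)
  show "a *\<^sub>R b *\<^sub>R f = (a * b) *\<^sub>R f"
    by transfer (auto simp: ae_eq_unit_def mult.assoc dest: square_integrable_cmult)
  show "1 *\<^sub>R f = f"
    by transfer (auto simp: ae_eq_unit_def)
qed

end

instantiation L2 :: real_inner
begin

lift_definition norm_L2 :: "L2 \<Rightarrow> real" is "\<lambda>f. sqrt (LINT x|lebesgue_unit. (cmod (f x))\<^sup>2)"
  by (auto simp: ae_eq_unit_def square_integrable_def intro!: integral_cong_AE)

text \<open>The real part of the Hilbert space inner product.\<close>

lift_definition inner_L2 :: "L2 \<Rightarrow> L2 \<Rightarrow> real" is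
  "\<lambda>f g. Re (LINT x|lebesgue_unit. f x * cnj (g x))"
  apply (intro arg_cong[where f=Re] integral_cong_AE)
  by (auto simp: ae_eq_unit_def square_integrable_def)

definition dist_L2 :: "L2 \<Rightarrow> L2 \<Rightarrow> real" where
  "dist_L2 f g = norm (f - g)"

definition sgn_L2 :: "L2 \<Rightarrow> L2" where
  "sgn_L2 f = f /\<^sub>R norm f"

definition uniformity_L2 :: "(L2 \<times> L2) filter" where
  "uniformity_L2 = (INF e\<in>{0<..}. principal {(f, g). dist f g < e})"

definition open_L2 :: "L2 set \<Rightarrow> bool" where
  "open_L2 U \<longleftrightarrow> (\<forall>f\<in>U. eventually (\<lambda>(f', g). f' = f \<longrightarrow> g \<in> U) uniformity)"

instance
proof
  fix f g h :: L2 and a :: real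
  show "sgn f = f /\<^sub>R norm f"
    by (rule sgn_L2_def)
  show "dist f g = norm (f - g)"
    by (rule dist_L2_def)
  show "uniformity = (INF e\<in>{0<..}. principal {(f, g :: L2). dist f g < e})"
    by (rule uniformity_L2_def)
  show "open U \<longleftrightarrow> (\<forall>f\<in>U. eventually (\<lambda>(f', g). f' = f \<longrightarrow> g \<in> U) uniformity)" for U :: "L2 set"
    by (rule open_L2_def)
  show "inner f g = inner g f"
  proof transfer
    fix f g assume "ae_eq_unit f f" "ae_eq_unit g g"
    have "(LINT x|lebesgue_unit. g x * cnj (f x)) = (LINT x|lebesgue_unit. cnj (f x * cnj (g x)))"
      by (simp add: mult.commute)
    also have "\<dots> = cnj (LINT x|lebesgue_unit. f x * cnj (g x))"
      by (rule Bochner_Integration.integral_cnj)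
    finally show "Re (LINT x|lebesgue_unit. f x * cnj (g x)) = Re (LINT x|lebesgue_unit. g x * cnj (f x))"
      by simp
  qed
  show "inner (f + g) h = inner f h + inner g h"
    by transfer (simp add: ae_eq_unit_def distrib_right square_integrable_inner)
  show "inner (a *\<^sub>R f) g = a * inner f g"
    by transfer (simp add: ae_eq_unit_def mult.assoc square_integrable_inner)
  have sq: "Re (LINT x|lebesgue_unit. u x * cnj (u x)) = (LINT x|lebesgue_unit. (cmod (u x))\<^sup>2)" for u
    by (simp only: complex_norm_square[symmetric] integral_complex_of_real Re_complex_of_real)
  show "0 \<le> inner f f"
    by transfer (simp add: sq)
  show "inner f f = 0 \<longleftrightarrow> f = 0"
  proof transfer
    fix u assume "ae_eq_unit u u"
    then have "square_integrable u"
      by (simp add: ae_eq_unit_def)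
    then show "Re (LINT x|lebesgue_unit. u x * cnj (u x)) = 0 \<longleftrightarrow> ae_eq_unit u (\<lambda>x. 0)"
      by (simp add: sq ae_eq_unit_def square_integrable_zero square_integrable_norm_square
          integral_nonneg_eq_0_iff_AE)
  qed
  show "norm f = sqrt (inner f f)"
    by transfer (simp add: sq)
qed

end

lift_definition scaleC :: "complex \<Rightarrow> L2 \<Rightarrow> L2" (infixr \<open>*\<^sub>C\<close> 75) is "\<lambda>c f x. c * f x"
  by (auto simp: ae_eq_unit_def square_integrable_cmult)

lemma scaleR_scaleC: "r *\<^sub>R f = complex_of_real r *\<^sub>C f"
  by transfer (auto simp: ae_eq_unit_def square_integrable_cmult)

lemma norm_scaleC: "norm (c *\<^sub>C f) = cmod c * norm f"
  by transfer (simp add: norm_mult power_mult_distrib real_sqrt_mult)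

lemma bounded_linear_scaleC: "bounded_linear (\<lambda>f. c *\<^sub>C f)"
proof
  fix f g :: L2 and r :: real
  show "c *\<^sub>C (f + g) = c *\<^sub>C f + c *\<^sub>C g"
    by transfer (auto simp: ae_eq_unit_def distrib_left intro!: square_integrable_add square_integrable_cmult)
  show "c *\<^sub>C r *\<^sub>R f = r *\<^sub>R c *\<^sub>C f"
    by transfer (auto simp: ae_eq_unit_def mult.left_commute intro!: square_integrable_cmult)
  show "\<exists>K. \<forall>f. norm (c *\<^sub>C f) \<le> norm f * K"
    by (rule exI[of _ "cmod c"]) (simp add: norm_scaleC)
qed


lemma integral_le_sqrt_integral_square:
  assumes "square_integrable f"
  shows "(LINT x|lebesgue_unit. cmod (f x)) \<le> sqrt (LINT x|lebesgue_unit. (cmod (f x))\<^sup>2)"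
proof (rule real_le_rsqrt)
  let ?m = "LINT x|lebesgue_unit. cmod (f x)"
  have int1: "integrable lebesgue_unit (\<lambda>x. cmod (f x))"
    using square_integrable_integrable[OF assms] by simp
  note int2 = square_integrable_norm_square[OF assms]
  have int3: "integrable lebesgue_unit (\<lambda>x. ?m\<^sup>2)"
    by (rule continuous_imp_integrable_real) simp
  have one: "measure lebesgue_unit {0..1} = 1"
    by (simp add: measure_restrict_space)
  have "0 \<le> (LINT x|lebesgue_unit. (cmod (f x) - ?m)\<^sup>2)"
    by simp
  also have "\<dots> = (LINT x|lebesgue_unit. (cmod (f x))\<^sup>2 - (2 * ?m) * cmod (f x) + ?m\<^sup>2)"
    by (simp add: power2_diff algebra_simps)
  also have "\<dots> = (LINT x|lebesgue_unit. (cmod (f x))\<^sup>2) - (2 * ?m) * ?m + ?m\<^sup>2"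
    using int1 int2 int3 one
    by (subst Bochner_Integration.integral_add Bochner_Integration.integral_diff;
        (intro Bochner_Integration.integrable_diff integrable_mult_right)?; simp)
  finally show "?m\<^sup>2 \<le> (LINT x|lebesgue_unit. (cmod (f x))\<^sup>2)"
    by (simp add: power2_eq_square)
qed

lemma L2_cases:
  obtains f where "square_integrable f" "F = abs_L2 f"
  using Quotient3_abs_rep[OF Quotient3_L2, of F] Quotient3_rep_reflp[OF Quotient3_L2, of F]
  by (metis ae_eq_unit_def)

lemma norm_abs_L2:
  "square_integrable f \<Longrightarrow> norm (abs_L2 f) = sqrt (LINT x|lebesgue_unit. (cmod (f x))\<^sup>2)"
  by (rule norm_L2.abs_eq) (simp add: ae_eq_unit_def)

lemma diff_abs_L2:
  "square_integrable f \<Longrightarrow> square_integrable g \<Longrightarrow> abs_L2 f - abs_L2 g = abs_L2 (\<lambda>x. f x - g x)"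
  by (rule minus_L2.abs_eq) (simp_all add: ae_eq_unit_def)

text \<open>Completeness (Riesz--Fischer).\<close>

lemma Cauchy_fast_subseq:
  fixes X :: "nat \<Rightarrow> 'a::metric_space"
  assumes "Cauchy X"
  obtains r :: "nat \<Rightarrow> nat" where "strict_mono r"
    "\<And>n. dist (X (r (Suc n))) (X (r n)) < (1/2) ^ n"
proof -
  have "\<exists>N. \<forall>a\<ge>N. \<forall>b\<ge>N. dist (X a) (X b) < (1/2) ^ n" for n
    using assms by (auto simp: Cauchy_def)
  then obtain N where N: "\<And>n a b. a \<ge> N n \<Longrightarrow> b \<ge> N n \<Longrightarrow> dist (X a) (X b) < (1/2) ^ n"
    by metis
  define r where "r n = (\<Sum>i\<le>n. N i) + n" for n
  have r: "strict_mono r"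
    by (rule strict_monoI_Suc) (simp add: r_def)
  have ge: "r n \<ge> N n" for n
    using member_le_sum[of n "{..n}" N] by (simp add: r_def)
  have "dist (X (r (Suc n))) (X (r n)) < (1/2) ^ n" for n
    by (intro N) (use ge[of n] strict_monoD[OF r, of n "Suc n"] in auto)
  with r show thesis by (rule that)
qed

instance L2 :: banach
proof
  fix X :: "nat \<Rightarrow> L2"
  assume X: "Cauchy X"
  obtain r where r: "strict_mono r" and fast: "\<And>n. dist (X (r (Suc n))) (X (r n)) < (1/2) ^ n"
    using Cauchy_fast_subseq[OF X] by blast
  have "\<exists>f. \<forall>n. square_integrable (f n) \<and> X (r n) = abs_L2 (f n)"
    by (intro choice allI) (metis L2_cases)
  then obtain f where sq: "\<And>n. square_integrable (f n)" and Xf: "\<And>n. X (r n) = abs_L2 (f n)"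
    by blast
  have [measurable]: "f n \<in> borel_measurable lebesgue_unit" for n
    by (rule square_integrable_measurable[OF sq])
  have nn: "(\<integral>\<^sup>+x. (cmod (f n x - f m x))\<^sup>2 \<partial>lebesgue_unit) = ennreal ((norm (X (r n) - X (r m)))\<^sup>2)" for n m
    using square_integrable_norm_square[OF square_integrable_diff[OF sq[of n] sq[of m]]]
    by (simp add: Xf diff_abs_L2 norm_abs_L2 sq square_integrable_diff nn_integral_eq_integral)
  have step: "(\<integral>\<^sup>+x. cmod (f (Suc n) x - f n x) \<partial>lebesgue_unit) \<le> ennreal ((1/2) ^ n)" for n
  proof -
    have sqd: "square_integrable (\<lambda>x. f (Suc n) x - f n x)"
      by (intro square_integrable_diff sq)
    have "(LINT x|lebesgue_unit. cmod (f (Suc n) x - f n x)) \<le> norm (X (r (Suc n)) - X (r n))"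
      using integral_le_sqrt_integral_square[OF sqd] by (simp add: Xf diff_abs_L2 norm_abs_L2 sq sqd)
    also have "\<dots> \<le> (1/2) ^ n"
      using fast[of n] by (simp add: dist_norm)
    finally show ?thesis
      using square_integrable_integrable[OF sqd]
      by (subst nn_integral_eq_integral) (auto intro: ennreal_leI)
  qed
  have "(\<integral>\<^sup>+x. (\<Sum>n. ennreal (cmod (f (Suc n) x - f n x))) \<partial>lebesgue_unit)
      = (\<Sum>n. \<integral>\<^sup>+x. cmod (f (Suc n) x - f n x) \<partial>lebesgue_unit)"
    by (rule nn_integral_suminf) measurable
  also have "\<dots> \<le> (\<Sum>n. ennreal ((1/2) ^ n))"
    by (intro suminf_le step) auto
  also have "\<dots> = ennreal 2"
    using power_half_series by (intro suminf_ennreal_eq) (auto simp: geometric_sums[of "1/2::real", simplified])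
  also have "\<dots> < \<infinity>"
    by simp
  finally have "AE x in lebesgue_unit. (\<Sum>n. ennreal (cmod (f (Suc n) x - f n x))) \<noteq> \<infinity>"
    by (intro nn_integral_noteq_infinite) auto
  then have conv: "AE x in lebesgue_unit. convergent (\<lambda>n. f n x)"
  proof eventually_elim
    case (elim x)
    then have "summable (\<lambda>n. cmod (f (Suc n) x - f n x))"
      by (intro summable_suminf_not_top) auto
    then have "summable (\<lambda>n. f (Suc n) x - f n x)"
      by (rule summable_norm_cancel)
    then have "convergent (\<lambda>n. (\<Sum>i<n. f (Suc i) x - f i x))"
      by (simp add: summable_iff_convergent)
    then have "convergent (\<lambda>n. f n x - f 0 x)"
      by (simp add: sum_lessThan_telescope[of "\<lambda>n. f n x"])
    from convergent_add[OF this convergent_const[of "f 0 x"]] show ?case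
      by simp
  qed
  define g where "g x = lim (\<lambda>n. f n x)" for x
  have g_meas [measurable]: "g \<in> borel_measurable lebesgue_unit"
    unfolding g_def by measurable
  have bound: "(\<integral>\<^sup>+x. (cmod (g x - f m x))\<^sup>2 \<partial>lebesgue_unit) \<le> ennreal (e\<^sup>2)"
    if "\<And>n. n \<ge> m \<Longrightarrow> norm (X (r n) - X (r m)) \<le> e" for m e
  proof -
    have "(\<integral>\<^sup>+x. (cmod (g x - f m x))\<^sup>2 \<partial>lebesgue_unit)
        = (\<integral>\<^sup>+x. liminf (\<lambda>n. ennreal ((cmod (f n x - f m x))\<^sup>2)) \<partial>lebesgue_unit)"
    proof (rule nn_integral_cong_AE, use conv in eventually_elim)
      case (elim x)
      then have "(\<lambda>n. f n x) \<longlonglongrightarrow> g x"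
        by (simp add: g_def convergent_LIMSEQ_iff)
      then have "(\<lambda>n. ennreal ((cmod (f n x - f m x))\<^sup>2)) \<longlonglongrightarrow> ennreal ((cmod (g x - f m x))\<^sup>2)"
        by (intro tendsto_ennrealI tendsto_intros)
      from lim_imp_Liminf[OF _ this] show ?case
        by simp
    qed
    also have "\<dots> \<le> liminf (\<lambda>n. \<integral>\<^sup>+x. (cmod (f n x - f m x))\<^sup>2 \<partial>lebesgue_unit)"
      by (rule nn_integral_liminf) measurable
    also have "\<dots> \<le> ennreal (e\<^sup>2)"
    proof -
      have "\<forall>\<^sub>F n in sequentially. (\<integral>\<^sup>+x. (cmod (f n x - f m x))\<^sup>2 \<partial>lebesgue_unit) \<le> ennreal (e\<^sup>2)"
        unfolding nn using eventually_ge_at_top[of m]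
        by eventually_elim (auto intro!: ennreal_leI power_mono that)
      then have "liminf (\<lambda>n. \<integral>\<^sup>+x. (cmod (f n x - f m x))\<^sup>2 \<partial>lebesgue_unit) \<le> liminf (\<lambda>n. ennreal (e\<^sup>2))"
        by (rule Liminf_mono)
      then show ?thesis
        by (simp add: Liminf_const)
    qed
    finally show ?thesis .
  qed
  have sq_bound: "square_integrable (\<lambda>x. g x - f m x)"
    if "\<And>n. n \<ge> m \<Longrightarrow> norm (X (r n) - X (r m)) \<le> e" for m e
  proof -
    have "integrable lebesgue_unit (\<lambda>x. (cmod (g x - f m x))\<^sup>2)"
    proof (rule integrableI_bounded)
      have "(\<integral>\<^sup>+x. (cmod (g x - f m x))\<^sup>2 \<partial>lebesgue_unit) \<le> ennreal (e\<^sup>2)"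
        by (rule bound) (rule that)
      then show "(\<integral>\<^sup>+x. ennreal (norm ((cmod (g x - f m x))\<^sup>2)) \<partial>lebesgue_unit) < \<infinity>"
        by (simp add: order_le_less_trans[OF _ ennreal_less_top])
    qed measurable
    then show ?thesis
      by (simp add: square_integrable_def)
  qed
  have ev: "\<exists>M. \<forall>m\<ge>M. \<forall>n\<ge>m. norm (X (r n) - X (r m)) \<le> e" if "e > 0" for e
  proof -
    have "Cauchy (X \<circ> r)"
      by (rule Cauchy_subseq_Cauchy[OF X r])
    then show ?thesis
      using that unfolding Cauchy_def by (simp add: dist_norm) (meson less_imp_le order_trans)
  qed
  have g_sq: "square_integrable g"
  proof -
    obtain M where "\<forall>m\<ge>M. \<forall>n\<ge>m. norm (X (r n) - X (r m)) \<le> 1"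
      using ev[of 1] by auto
    then have "square_integrable (\<lambda>x. g x - f M x)"
      by (intro sq_bound[where e = 1]) auto
    from square_integrable_add[OF this sq[of M]] show ?thesis
      by simp
  qed
  have "(X \<circ> r) \<longlonglongrightarrow> abs_L2 g"
  proof (rule LIMSEQ_I)
    fix e :: real assume "e > 0"
    then obtain M where M: "\<forall>m\<ge>M. \<forall>n\<ge>m. norm (X (r n) - X (r m)) \<le> e / 2"
      using ev[of "e / 2"] by auto
    have "norm ((X \<circ> r) m - abs_L2 g) < e" if "m \<ge> M" for m
    proof -
      have sqd: "square_integrable (\<lambda>x. g x - f m x)"
        by (intro square_integrable_diff sq g_sq)
      have "(\<integral>\<^sup>+x. (cmod (g x - f m x))\<^sup>2 \<partial>lebesgue_unit) \<le> ennreal ((e / 2)\<^sup>2)"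
        by (intro bound) (use M that in auto)
      then have "(LINT x|lebesgue_unit. (cmod (g x - f m x))\<^sup>2) \<le> (e / 2)\<^sup>2"
        using square_integrable_norm_square[OF sqd] by (simp add: nn_integral_eq_integral)
      then have "norm (abs_L2 g - X (r m)) \<le> e / 2"
        using \<open>e > 0\<close> real_le_lsqrt[of "e / 2"]
        by (simp add: Xf diff_abs_L2 norm_abs_L2 sq sqd g_sq del: le_divide_eq_numeral1)
      then show ?thesis
        using \<open>e > 0\<close> by (simp add: norm_minus_commute)
    qed
    then show "\<exists>M. \<forall>m\<ge>M. norm ((X \<circ> r) m - abs_L2 g) < e"
      by blast
  qed
  then show "convergent X"
    using Cauchy_converges_subseq[OF X r] by (auto simp: convergent_def)
qed

text \<open>
  The values of \<open>volterra_fun f\<close> outside \<open>[0,1]\<close> are irrelevant: \<^typ>\<open>L2\<close> identifies functions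
  that agree almost everywhere on \<open>[0,1]\<close>.
\<close>

definition volterra_fun :: "(real \<Rightarrow> complex) \<Rightarrow> real \<Rightarrow> complex" where
  "volterra_fun f x = (LINT t|lebesgue_on {0..x}. f t)"

lemma continuous_on_volterra_fun:
  "square_integrable f \<Longrightarrow> continuous_on {0..1} (volterra_fun f)"
  unfolding volterra_fun_def[abs_def]
  by (rule indefinite_integral_continuous_real[OF square_integrable_integrable])

lemma square_integrable_continuous:
  assumes "continuous_on {0..1} f"
  shows "square_integrable f"
  using assms unfolding square_integrable_def
  by (auto intro!: continuous_imp_measurable_on_sets_lebesgue continuous_imp_integrable_real continuous_intros)

lemma square_integrable_volterra_fun: "square_integrable f \<Longrightarrow> square_integrable (volterra_fun f)"
  by (rule square_integrable_continuous[OF continuous_on_volterra_fun])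

lemma square_integrable_integrable_Icc:
  "square_integrable f \<Longrightarrow> x \<in> {0..1} \<Longrightarrow> integrable (lebesgue_on {0..x}) f"
  by (rule integrable_subinterval[where a = 0 and b = 1]) (auto intro: square_integrable_integrable)

lemma volterra_fun_cong_AE:
  assumes "ae_eq_unit f g" "x \<in> {0..1}"
  shows "volterra_fun f x = volterra_fun g x"
  unfolding volterra_fun_def
proof (rule integral_cong_AE)
  show "f \<in> borel_measurable (lebesgue_on {0..x})" "g \<in> borel_measurable (lebesgue_on {0..x})"
    using assms by (auto simp: ae_eq_unit_def intro!: borel_measurable_integrable square_integrable_integrable_Icc)
  have "AE t in lebesgue. t \<in> {0..1} \<longrightarrow> f t = g t"
    using assms by (simp add: ae_eq_unit_def AE_restrict_space_iff)
  then have "AE t in lebesgue. t \<in> {0..x} \<longrightarrow> f t = g t"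
    by eventually_elim (use assms in auto)
  then show "AE t in lebesgue_on {0..x}. f t = g t"
    by (simp add: AE_restrict_space_iff)
qed

lift_definition volterra :: "L2 \<Rightarrow> L2" is volterra_fun
proof -
  fix f g assume fg: "ae_eq_unit f g"
  then have "square_integrable f" "square_integrable g"
    by (auto simp: ae_eq_unit_def)
  moreover have "AE x in lebesgue_unit. volterra_fun f x = volterra_fun g x"
    by (rule AE_I2) (use volterra_fun_cong_AE[OF fg] in simp)
  ultimately show "ae_eq_unit (volterra_fun f) (volterra_fun g)"
    by (simp add: ae_eq_unit_def square_integrable_volterra_fun)
qed

lemma ae_eq_unitI:
  "square_integrable f \<Longrightarrow> square_integrable g \<Longrightarrow> (\<And>x. x \<in> {0..1} \<Longrightarrow> f x = g x) \<Longrightarrow> ae_eq_unit f g"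
  by (auto simp: ae_eq_unit_def intro!: AE_I2)

lemma volterra_add: "volterra (F + G) = volterra F + volterra G"
proof transfer
  fix f g assume "ae_eq_unit f f" "ae_eq_unit g g"
  then have "square_integrable f" "square_integrable g"
    by (auto simp: ae_eq_unit_def)
  then show "ae_eq_unit (volterra_fun (\<lambda>x. f x + g x)) (\<lambda>x. volterra_fun f x + volterra_fun g x)"
    by (intro ae_eq_unitI square_integrable_volterra_fun square_integrable_add)
      (simp_all add: volterra_fun_def square_integrable_integrable_Icc)
qed

lemma volterra_scaleC: "volterra (c *\<^sub>C F) = c *\<^sub>C volterra F"
proof transfer
  fix c f assume "ae_eq_unit f f"
  then have "square_integrable f"
    by (auto simp: ae_eq_unit_def)
  then show "ae_eq_unit (volterra_fun (\<lambda>x. c * f x)) (\<lambda>x. c * volterra_fun f x)"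
    by (intro ae_eq_unitI square_integrable_volterra_fun square_integrable_cmult)
      (simp_all add: volterra_fun_def square_integrable_integrable_Icc)
qed

lemma norm_volterra_fun_le:
  assumes f: "square_integrable f" and x: "x \<in> {0..1}"
  shows "cmod (volterra_fun f x) \<le> (LINT t|lebesgue_on {0..x}. cmod (f t))"
    and "(LINT t|lebesgue_on {0..x}. cmod (f t)) \<le> norm (abs_L2 f)"
proof -
  show "cmod (volterra_fun f x) \<le> (LINT t|lebesgue_on {0..x}. cmod (f t))"
    unfolding volterra_fun_def by (rule integral_norm_bound)
  have "integrable (lebesgue_on {0..x}) (\<lambda>t. cmod (f t))" "integrable lebesgue_unit (\<lambda>t. cmod (f t))"
    using square_integrable_integrable_Icc[OF f] x square_integrable_integrable[OF f] by auto
  then have "(LINT t|lebesgue_on {0..x}. cmod (f t)) \<le> (LINT t|lebesgue_unit. cmod (f t))"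
    by (simp add: lebesgue_integral_eq_integral)
      (intro integral_subset_le integrable_on_lebesgue_on; use x in auto)
  also have "\<dots> \<le> norm (abs_L2 f)"
    by (simp add: norm_abs_L2 f integral_le_sqrt_integral_square)
  finally show "(LINT t|lebesgue_on {0..x}. cmod (f t)) \<le> norm (abs_L2 f)" .
qed

lemma norm_abs_L2_le:
  assumes "square_integrable f" "\<And>x. x \<in> {0..1} \<Longrightarrow> cmod (f x) \<le> B"
  shows "norm (abs_L2 f) \<le> B"
proof -
  have B: "0 \<le> B"
    using order_trans[OF norm_ge_zero assms(2)[of 0]] by simp
  have "(LINT x|lebesgue_unit. (cmod (f x))\<^sup>2) \<le> (LINT x|lebesgue_unit. B\<^sup>2)"
    using assms by (intro integral_mono square_integrable_norm_square continuous_imp_integrable_real) (auto intro: power_mono)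
  also have "\<dots> = B\<^sup>2"
    by (simp add: measure_restrict_space)
  finally show ?thesis
    using B by (simp add: norm_abs_L2 assms(1) real_le_lsqrt)
qed

lemma bounded_linear_volterra: "bounded_linear volterra"
proof
  fix F G :: L2 and r :: real
  show "volterra (F + G) = volterra F + volterra G"
    by (rule volterra_add)
  show "volterra (r *\<^sub>R F) = r *\<^sub>R volterra F"
    by (simp add: scaleR_scaleC volterra_scaleC)
  have "norm (volterra F) \<le> norm F * 1" for F
  proof (cases F rule: L2_cases)
    case (1 f)
    then show ?thesis
      by (auto simp: volterra.abs_eq ae_eq_unit_def square_integrable_volterra_fun
          intro!: norm_abs_L2_le order_trans[OF norm_volterra_fun_le(1) norm_volterra_fun_le(2)])
  qed
  then show "\<exists>K. \<forall>F. norm (volterra F) \<le> norm F * K"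
    by blast
qed

lemma volterra_funpow_abs:
  assumes "square_integrable f"
  shows "square_integrable ((volterra_fun ^^ m) f)"
    and "(volterra ^^ m) (abs_L2 f) = abs_L2 ((volterra_fun ^^ m) f)"
  using assms
  by (induction m) (auto simp: volterra.abs_eq ae_eq_unit_def square_integrable_volterra_fun)

lemma norm_volterra_funpow_fun_le:
  assumes f: "square_integrable f" and x: "x \<in> {0..1}"
  shows "cmod ((volterra_fun ^^ Suc m) f x) \<le> norm (abs_L2 f) * x ^ m / fact m"
  using x
proof (induction m arbitrary: x)
  case 0
  then show ?case
    using order_trans[OF norm_volterra_fun_le[OF f]] by simp
next
  case (Suc m)
  let ?A = "norm (abs_L2 f)" and ?h = "(volterra_fun ^^ Suc m) f"
  have h: "square_integrable ?h"
    by (rule volterra_funpow_abs[OF f])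
  have "((\<lambda>t. ?A * t ^ Suc m / fact (Suc m)) has_real_derivative
      ?A * (real (Suc m) * t ^ m) / fact (Suc m)) (at t within {0..x})" for t
    by (rule derivative_eq_intros refl | simp)+
  moreover have "?A * (real (Suc m) * t ^ m) / fact (Suc m) = ?A * t ^ m / fact m" for t
    by (simp add: fact_Suc del: of_nat_Suc)
  ultimately have "((\<lambda>t. ?A * t ^ Suc m / fact (Suc m)) has_vector_derivative ?A * t ^ m / fact m)
      (at t within {0..x})" for t
    by (simp only: has_real_derivative_iff_has_vector_derivative)
  then have int: "((\<lambda>t. ?A * t ^ m / fact m) has_integral
      (?A * x ^ Suc m / fact (Suc m) - ?A * 0 ^ Suc m / fact (Suc m))) {0..x}"
    using Suc.prems by (intro fundamental_theorem_of_calculus) auto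
  have "cmod (volterra_fun ?h x) = cmod (integral {0..x} ?h)"
    using Suc.prems by (simp only: volterra_fun_def)
      (subst lebesgue_integral_eq_integral[OF square_integrable_integrable_Icc[OF h]]; simp)
  also have "\<dots> \<le> integral {0..x} (\<lambda>t. ?A * t ^ m / fact m)"
  proof (rule Henstock_Kurzweil_Integration.integral_norm_bound_integral)
    show "?h integrable_on {0..x}"
      by (rule integrable_on_lebesgue_on[OF square_integrable_integrable_Icc[OF h]]) (use Suc.prems in auto)
    show "(\<lambda>t. ?A * t ^ m / fact m) integrable_on {0..x}"
      using int by blast
    show "cmod (?h t) \<le> ?A * t ^ m / fact m" if "t \<in> {0..x}" for t
      by (rule Suc.IH) (use that Suc.prems in auto)
  qed
  also have "\<dots> = ?A * x ^ Suc m / fact (Suc m)"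
    using integral_unique[OF int] by simp
  finally show ?case
    by simp
qed

lemma norm_volterra_funpow_le: "norm ((volterra ^^ m) F) \<le> norm F / fact (m - 1)"
proof (cases m)
  case 0
  then show ?thesis by simp
next
  case (Suc k)
  obtain f where f: "square_integrable f" "F = abs_L2 f"
    by (rule L2_cases)
  have "norm (abs_L2 ((volterra_fun ^^ Suc k) f)) \<le> norm (abs_L2 f) / fact k"
  proof (rule norm_abs_L2_le[OF volterra_funpow_abs(1)[OF f(1)]])
    fix x :: real assume x: "x \<in> {0..1}"
    have "cmod ((volterra_fun ^^ Suc k) f x) \<le> norm (abs_L2 f) * x ^ k / fact k"
      by (rule norm_volterra_funpow_fun_le[OF f(1) x])
    also have "\<dots> \<le> norm (abs_L2 f) / fact k"
      using x by (intro divide_right_mono) (auto intro: mult_left_le simp: power_le_one)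
    finally show "cmod ((volterra_fun ^^ Suc k) f x) \<le> norm (abs_L2 f) / fact k" .
  qed
  then show ?thesis
    using volterra_funpow_abs(2)[OF f(1), of "Suc k"] Suc f(2) by simp
qed

lemma Neumann_inverse:
  fixes T :: "'a::banach \<Rightarrow> 'a"
  assumes T: "bounded_linear T"
    and le: "\<And>k x. norm ((T ^^ k) x) \<le> c k * norm x" and c: "summable c"
  shows "bij (\<lambda>x. x - T x)" and "bounded_linear (inv (\<lambda>x. x - T x))"
proof -
  interpret T: bounded_linear T by fact
  define S where "S x = (\<Sum>k. (T ^^ k) x)" for x
  have sum_norm: "summable (\<lambda>k. norm ((T ^^ k) x))" for x
    by (rule summable_comparison_test'[OF summable_mult2[OF c, of "norm x"], of 0]) (use le in auto)
  note sum = summable_norm_cancel[OF sum_norm]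
  have lin: "linear (T ^^ k)" for k
  proof (induction k)
    case 0
    then show ?case by (simp add: linear_id[unfolded id_def] id_def)
  next
    case (Suc k)
    then show ?case using linear_compose[OF Suc T.linear_axioms] by (simp add: comp_def)
  qed
  have TS: "T (S x) = S x - x" for x
  proof -
    have "T (S x) = (\<Sum>k. (T ^^ Suc k) x)"
      unfolding S_def by (simp add: T.suminf[OF sum])
    also have "\<dots> = S x - x"
      unfolding S_def by (subst suminf_split_head[OF sum]) simp
    finally show ?thesis .
  qed
  have ST: "S (x - T x) = x" for x
  proof -
    have "S (x - T x) = (\<Sum>k. (T ^^ k) x - (T ^^ Suc k) x)"
      unfolding S_def by (simp add: linear_diff[OF lin] funpow_swap1)
    also have "\<dots> = S x - (\<Sum>k. (T ^^ Suc k) x)"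
      unfolding S_def using sum[of x] T.summable[OF sum[of x]] by (subst suminf_diff) auto
    also have "\<dots> = x"
      unfolding S_def by (subst suminf_split_head[OF sum]) simp
    finally show ?thesis .
  qed
  show bij: "bij (\<lambda>x. x - T x)"
    by (rule o_bij[of S]) (auto simp: fun_eq_iff ST TS)
  have "inv (\<lambda>x. x - T x) = S"
    by (rule inv_unique_comp) (auto simp: fun_eq_iff ST TS)
  moreover have "bounded_linear S"
  proof
    fix x y :: 'a and r :: real
    show "S (x + y) = S x + S y"
      unfolding S_def by (simp add: linear_add[OF lin] suminf_add[OF sum sum])
    show "S (r *\<^sub>R x) = r *\<^sub>R S x"
      unfolding S_def by (simp add: linear_scale[OF lin] suminf_scaleR_right[OF sum])
    have "norm (S x) \<le> norm x * suminf c" for x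
    proof -
      have "norm (S x) \<le> (\<Sum>k. norm ((T ^^ k) x))"
        unfolding S_def by (rule summable_norm[OF sum_norm])
      also have "\<dots> \<le> (\<Sum>k. c k * norm x)"
        by (intro suminf_le le sum_norm summable_mult2 c)
      also have "\<dots> = norm x * suminf c"
        by (subst mult.commute, rule suminf_mult[OF c])
      finally show ?thesis .
    qed
    then show "\<exists>K. \<forall>x. norm (S x) \<le> norm x * K"
      by blast
  qed
  ultimately show "bounded_linear (inv (\<lambda>x. x - T x))"
    by simp
qed

lemma bounded_linear_volterra_funpow: "bounded_linear (volterra ^^ n)"
  by (induction n)
    (auto intro: bounded_linear_volterra bounded_linear_ident bounded_linear_compose simp: comp_def id_def)

lemma volterra_funpow_scaleC: "(volterra ^^ n) (c *\<^sub>C F) = c *\<^sub>C (volterra ^^ n) F"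
  by (induction n) (auto simp: volterra_scaleC)

lemma scaleC_scaleC: "a *\<^sub>C b *\<^sub>C F = (a * b) *\<^sub>C F"
  by transfer (auto simp: ae_eq_unit_def mult.assoc intro!: square_integrable_cmult)

lemma scaleC_minus_left: "(- a) *\<^sub>C F = - (a *\<^sub>C F)"
  by transfer (auto simp: ae_eq_unit_def intro!: square_integrable_cmult square_integrable_uminus)

lemma scaleC_one: "1 *\<^sub>C F = F"
  by transfer (auto simp: ae_eq_unit_def)

text \<open>Well-definedness of \<open>(I + \<mu> V\<^sup>n)\<^sup>-\<^sup>1\<close>, so that \<^const>\<open>inv\<close> and \<^const>\<open>onorm\<close> have their usual meaning.\<close>

lemma id_plus_volterra_funpow_inverse:
  assumes "n \<ge> 1"
  shows "bij (\<lambda>F. F + \<mu> *\<^sub>C (volterra ^^ n) F)" and "bounded_linear (inv (\<lambda>F. F + \<mu> *\<^sub>C (volterra ^^ n) F))"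
proof -
  define T where "T F = (- \<mu>) *\<^sub>C (volterra ^^ n) F" for F
  have T: "bounded_linear T"
    unfolding T_def by (intro bounded_linear_compose[OF bounded_linear_scaleC bounded_linear_volterra_funpow])
  have pow: "(T ^^ k) F = (- \<mu>) ^ k *\<^sub>C (volterra ^^ (n * k)) F" for k F
    by (induction k)
      (auto simp: T_def scaleC_one volterra_funpow_scaleC scaleC_scaleC funpow_add)
  define c where "c k = cmod \<mu> ^ k / fact (k - 1)" for k
  have "summable (\<lambda>k. cmod \<mu> * (inverse (fact k) * cmod \<mu> ^ k))"
    by (intro summable_mult summable_exp)
  then have "summable (\<lambda>k. c (Suc k))"
    by (simp add: c_def field_simps)
  then have c: "summable c"
    by (simp add: summable_Suc_iff)
  have le: "norm ((T ^^ k) F) \<le> c k * norm F" for k F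
  proof -
    have "norm ((T ^^ k) F) \<le> cmod \<mu> ^ k * (norm F / fact (n * k - 1))"
      unfolding pow norm_scaleC norm_power norm_minus_cancel
      by (intro mult_left_mono norm_volterra_funpow_le) simp
    also have "\<dots> \<le> cmod \<mu> ^ k * (norm F / fact (k - 1))"
      using assms by (intro mult_left_mono divide_left_mono fact_mono diff_le_mono) auto
    finally show ?thesis
      by (simp add: c_def)
  qed
  have eq: "(\<lambda>F. F + \<mu> *\<^sub>C (volterra ^^ n) F) = (\<lambda>F. F - T F)"
    by (simp add: T_def scaleC_minus_left)
  show "bij (\<lambda>F. F + \<mu> *\<^sub>C (volterra ^^ n) F)" "bounded_linear (inv (\<lambda>F. F + \<mu> *\<^sub>C (volterra ^^ n) F))"
    unfolding eq by (rule Neumann_inverse[OF T le c])+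
qed

end

theory Submission
  imports Defs "HOL-Real_Asymp.Real_Asymp"
begin

text \<open>
  If the norm were at most \<open>1\<close>, then \<open>\<parallel>f + \<lambda> V\<^sup>n f\<parallel> \<le> \<parallel>f + \<mu> V\<^sup>n f\<parallel>\<close> would hold for every \<open>f\<close>. The
  exponentials \<open>E\<^sub>z(t) = exp (z t)\<close> violate this inequality for a suitable \<open>z\<close> in the right half-plane.

  Since \<open>z V E\<^sub>z = E\<^sub>z - 1\<close>, iteration gives \<open>z\<^sup>n V\<^sup>n E\<^sub>z = E\<^sub>z - p\<close>, where \<open>p\<close> is a Taylor
  polynomial, whose norm grows only polynomially in \<open>z\<close>
  (\<open>norm_volterra_funpow_exp_L2_remainder\<close>). The norm of \<open>E\<^sub>z\<close> itself grows exponentially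
  when \<open>z\<close> tends to infinity along a ray \<open>z = R w\<close> with \<open>Re w > 0\<close> (\<open>norm_exp_L2_ge\<close>). Hence
  \<open>E\<^sub>z\<close> is, up to an exponentially small relative error, an eigenvector of \<open>V\<^sup>n\<close> for
  \<open>\<epsilon> = z\<^bsup>-n\<^esup>\<close>, although \<open>V\<^sup>n\<close> is quasinilpotent. The two norms to be compared are therefore
  essentially \<open>\<bar>1 + \<lambda> \<epsilon>\<bar> \<parallel>E\<^sub>z\<parallel>\<close> and \<open>\<bar>1 + \<mu> \<epsilon>\<bar> \<parallel>E\<^sub>z\<parallel>\<close>.

  To first order in \<open>\<epsilon>\<close>, the difference \<open>\<bar>1 + \<lambda> \<epsilon>\<bar> - \<bar>1 + \<mu> \<epsilon>\<bar>\<close> is \<open>Re ((\<lambda> - \<mu>) \<epsilon>)\<close>, so it is at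
  least a positive multiple of \<open>R\<^bsup>-n\<^esup>\<close> as soon as \<open>Re ((\<lambda> - \<mu>) w\<^bsup>-n\<^esup>) > 0\<close>. This is where \<open>n \<ge> 2\<close>
  enters: when \<open>w\<close> runs through the open right half of the unit circle, the arguments of \<open>w\<^bsup>-n\<^esup>\<close>
  fill an open arc of length \<open>n \<pi> \<ge> 2 \<pi>\<close>, so \<open>w\<^bsup>-n\<^esup>\<close> meets every open half-plane bounded by a
  line through \<open>0\<close> (\<open>obtain_direction\<close>). For \<open>n = 1\<close> the arc is only a half circle and the
  argument breaks down.
\<close>

section \<open>Complex scalar multiples and representatives\<close>

lemma scaleC_diff_right: "c *\<^sub>C (F - G) = c *\<^sub>C F - c *\<^sub>C G"
  by (rule bounded_linear.linear[OF bounded_linear_scaleC, THEN linear_diff])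

lemma scaleC_add_left: "(a + b) *\<^sub>C F = a *\<^sub>C F + b *\<^sub>C F"
  by transfer (auto simp: ae_eq_unit_def distrib_right intro!: square_integrable_add square_integrable_cmult)

lemma scaleC_abs_L2: "square_integrable f \<Longrightarrow> c *\<^sub>C abs_L2 f = abs_L2 (\<lambda>x. c * f x)"
  by (rule scaleC.abs_eq) (simp add: ae_eq_unit_def)

lemma volterra_abs_L2: "square_integrable f \<Longrightarrow> volterra (abs_L2 f) = abs_L2 (volterra_fun f)"
  by (rule volterra.abs_eq) (simp add: ae_eq_unit_def)

section \<open>Exponentials as approximate eigenvectors of the Volterra powers\<close>

definition exp_L2 :: "complex \<Rightarrow> L2" where
  "exp_L2 z = abs_L2 (\<lambda>t. exp (z * complex_of_real t))"

lemma square_integrable_exp: "square_integrable (\<lambda>t. exp (z * complex_of_real t))"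
  by (intro square_integrable_continuous continuous_intros)

lemma volterra_fun_exp:
  assumes "x \<in> {0..1}"
  shows "z * volterra_fun (\<lambda>t. exp (z * complex_of_real t)) x = exp (z * complex_of_real x) - 1"
proof -
  let ?e = "\<lambda>t. exp (z * complex_of_real t)"
  have "(?e has_vector_derivative z * ?e t) (at t within {0..x})" for t
    by (rule has_vector_derivative_real_field derivative_eq_intros refl | simp)+
  then have "((\<lambda>t. z * ?e t) has_integral ?e x - ?e 0) {0..x}"
    using assms by (intro fundamental_theorem_of_calculus) auto
  moreover have "((\<lambda>t. z * ?e t) has_integral z * integral {0..x} ?e) {0..x}"
    by (intro has_integral_mult_right integrable_integral integrable_continuous_real continuous_intros)
  moreover have "volterra_fun ?e x = integral {0..x} ?e"
    unfolding volterra_fun_def using assms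
    by (intro lebesgue_integral_eq_integral square_integrable_integrable_Icc square_integrable_exp) auto
  ultimately show ?thesis
    by (metis has_integral_unique exp_zero mult_zero_right of_real_0)
qed

text \<open>
  The fundamental theorem of calculus in \<open>L\<^sup>2\<close>. Writing the constant function \<open>1\<close> as \<open>exp_L2 0\<close>
  keeps the whole identity inside the family of exponentials.
\<close>

lemma scaleC_volterra_exp_L2: "z *\<^sub>C volterra (exp_L2 z) = exp_L2 z - exp_L2 0"
proof -
  have "abs_L2 (\<lambda>x. z * volterra_fun (\<lambda>t. exp (z * complex_of_real t)) x)
      = abs_L2 (\<lambda>x. exp (z * complex_of_real x) - exp (0 * complex_of_real x))"
    by (intro Quotient3_rel_abs[OF Quotient3_L2] ae_eq_unitI square_integrable_cmult
        square_integrable_volterra_fun square_integrable_diff square_integrable_exp)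
      (simp add: volterra_fun_exp)
  then show ?thesis
    by (simp only: exp_L2_def volterra_abs_L2 scaleC_abs_L2 diff_abs_L2 square_integrable_exp
        square_integrable_volterra_fun)
qed

lemma norm_exp_L2_zero: "norm (exp_L2 0) \<le> 1"
  unfolding exp_L2_def by (rule norm_abs_L2_le[OF square_integrable_exp]) simp

text \<open>
  The vector inside the norm is minus the sum of \<open>(z V)\<^sup>k 1\<close> over \<open>k < n\<close>, that is, minus the
  Taylor polynomial of \<open>exp (z t)\<close> of degree \<open>n - 1\<close>. The triangle inequality and
  \<open>\<parallel>V\<^sup>k 1\<parallel> \<le> 1\<close> bound it without computing the polynomial.
\<close>

lemma norm_volterra_funpow_exp_L2_remainder:
  "norm (z ^ n *\<^sub>C (volterra ^^ n) (exp_L2 z) - exp_L2 z) \<le> (\<Sum>k<n. cmod z ^ k)"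
proof (induction n)
  case 0
  then show ?case by (simp add: scaleC_one)
next
  case (Suc n)
  have "z ^ Suc n *\<^sub>C (volterra ^^ Suc n) (exp_L2 z) = z ^ n *\<^sub>C (volterra ^^ n) (z *\<^sub>C volterra (exp_L2 z))"
    by (simp add: funpow_swap1 volterra_funpow_scaleC scaleC_scaleC mult.commute)
  also have "\<dots> = z ^ n *\<^sub>C (volterra ^^ n) (exp_L2 z) - z ^ n *\<^sub>C (volterra ^^ n) (exp_L2 0)"
    by (simp add: scaleC_volterra_exp_L2 scaleC_diff_right
        bounded_linear.linear[OF bounded_linear_volterra_funpow, THEN linear_diff])
  finally have step: "z ^ Suc n *\<^sub>C (volterra ^^ Suc n) (exp_L2 z)
      = z ^ n *\<^sub>C (volterra ^^ n) (exp_L2 z) - z ^ n *\<^sub>C (volterra ^^ n) (exp_L2 0)" .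
  have triangle: "norm (A - B - E) \<le> norm (A - E) + norm B" for A B E :: L2
    using norm_triangle_ineq4[of "A - E" B] by (simp add: algebra_simps)
  have "norm (z ^ Suc n *\<^sub>C (volterra ^^ Suc n) (exp_L2 z) - exp_L2 z)
      \<le> norm (z ^ n *\<^sub>C (volterra ^^ n) (exp_L2 z) - exp_L2 z) + norm (z ^ n *\<^sub>C (volterra ^^ n) (exp_L2 0))"
    unfolding step by (rule triangle)
  also have "norm (z ^ n *\<^sub>C (volterra ^^ n) (exp_L2 0)) \<le> cmod z ^ n * 1"
  proof -
    have "norm ((volterra ^^ n) (exp_L2 0)) \<le> norm (exp_L2 0) / fact (n - 1)"
      by (rule norm_volterra_funpow_le)
    also have "\<dots> \<le> 1 / 1"
      using norm_exp_L2_zero by (intro frac_le) (auto simp: fact_ge_1)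
    finally show ?thesis
      unfolding norm_scaleC norm_power by (intro mult_left_mono) auto
  qed
  finally show ?case using Suc.IH by simp
qed

text \<open>
  On a probability space the \<open>L\<^sup>1\<close> norm is at most the \<open>L\<^sup>2\<close> norm, and the former is an
  elementary integral because \<open>\<bar>exp (z t)\<bar> = exp (t Re z)\<close>.
\<close>

lemma norm_exp_L2_ge:
  assumes "Re z > 0"
  shows "norm (exp_L2 z) \<ge> (exp (Re z) - 1) / Re z"
proof -
  have "((\<lambda>t. exp (Re z * t) / Re z) has_vector_derivative exp (Re z * t)) (at t within {0..1})" for t
    unfolding has_real_derivative_iff_has_vector_derivative[symmetric]
    by (rule derivative_eq_intros refl | use assms in simp)+
  then have "((\<lambda>t. exp (Re z * t)) has_integral exp (Re z * 1) / Re z - exp (Re z * 0) / Re z) {0..1}"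
    by (intro fundamental_theorem_of_calculus) auto
  then have "(exp (Re z) - 1) / Re z = integral {0..1} (\<lambda>t. exp (Re z * t))"
    by (simp add: integral_unique diff_divide_distrib)
  also have "\<dots> = (LINT t|lebesgue_unit. cmod (exp (z * complex_of_real t)))"
    by (subst lebesgue_integral_eq_integral)
      (auto intro!: continuous_imp_integrable_real continuous_intros)
  also have "\<dots> \<le> norm (exp_L2 z)"
    unfolding exp_L2_def norm_abs_L2[OF square_integrable_exp]
    by (rule integral_le_sqrt_integral_square[OF square_integrable_exp])
  finally show ?thesis .
qed

section \<open>Choice of the direction and first-order expansion\<close>

lemma exp_quotient_dominates_power:
  fixes c :: real assumes "c > 0"
  shows "filterlim (\<lambda>R. (exp (c * R) - 1) / (c * R) / R ^ n) at_top at_top"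
  using assms by real_asymp

lemma cmod_affine_has_derivative: "((\<lambda>s. cmod (1 + c * complex_of_real s)) has_real_derivative Re c) (at 0)"
  unfolding cmod_def
  by (rule derivative_eq_intros refl | simp)+

text \<open>
  Taking \<open>w\<close> with \<open>n arg w = arg d\<close> would make \<open>d / w\<^sup>n\<close> positive, but for \<open>n = 2\<close> and \<open>d < 0\<close> it
  gives \<open>w = \<i>\<close>, outside the open half-plane. Rotating only three quarters of the way keeps
  \<open>\<bar>arg w\<bar> \<le> 3 \<pi> / 8\<close> and leaves \<open>d / w\<^sup>n\<close> with argument at most \<open>\<pi> / 4\<close> in absolute value.
\<close>

lemma obtain_direction:
  fixes d :: complex
  assumes "n \<ge> 2" "d \<noteq> 0"
  obtains w where "cmod w = 1" "Re w > 0" "Re (d / w ^ n) > 0"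
proof
  define \<theta> where "\<theta> = 3 / 4 * Arg d"
  have A: "\<bar>Arg d\<bar> \<le> pi"
    using Arg_bounded[of d] by (simp add: abs_le_iff)
  have n: "real n \<ge> 2" using assms by simp
  let ?w = "cis (\<theta> / n)"
  show "cmod ?w = 1" by simp
  have "\<bar>\<theta> / n\<bar> \<le> \<bar>\<theta>\<bar> / 2"
    unfolding abs_divide using n by (intro divide_left_mono) auto
  also have "\<dots> < pi / 2" using A pi_gt_zero unfolding \<theta>_def abs_mult by linarith
  finally have "\<bar>\<theta> / n\<bar> < pi / 2" .
  then show "Re ?w > 0"
    unfolding cis.sel by (intro cos_gt_zero_pi) linarith+
  have "?w ^ n = cis \<theta>"
    using n by (simp add: Complex.DeMoivre)
  then have "d / ?w ^ n = complex_of_real (cmod d) * (cis (Arg d) / cis \<theta>)"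
    using rcis_cmod_Arg[of d] by (simp add: rcis_def)
  also have "cis (Arg d) / cis \<theta> = cis (Arg d / 4)"
    by (simp add: cis_divide \<theta>_def)
  finally have *: "Re (d / ?w ^ n) = cmod d * cos (Arg d / 4)" by simp
  have "cos (Arg d / 4) > 0"
    using A pi_gt_zero by (intro cos_gt_zero_pi) linarith+
  with * assms show "Re (d / ?w ^ n) > 0" by simp
qed

text \<open>
  The difference of moduli vanishes at \<open>s = 0\<close> and has derivative \<open>Re ((lam - mu) * a)\<close> there; half
  of this derivative serves as the slope \<open>k\<close>.
\<close>

lemma cmod_affine_gap:
  fixes lam mu a :: complex
  assumes "Re ((lam - mu) * a) > 0"
  obtains k where "k > 0"
    "\<forall>\<^sub>F s in at_right 0. cmod (1 + lam * a * complex_of_real s) - cmod (1 + mu * a * complex_of_real s) \<ge> k * s"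
proof
  let ?g = "\<lambda>s. cmod (1 + lam * a * complex_of_real s) - cmod (1 + mu * a * complex_of_real s)"
  let ?k = "Re ((lam - mu) * a)"
  show "?k / 2 > 0" using assms by simp
  have "(?g has_real_derivative Re (lam * a) - Re (mu * a)) (at 0)"
    by (intro DERIV_diff cmod_affine_has_derivative)
  then have "((\<lambda>s. ?g s / s) \<longlongrightarrow> ?k) (at 0)"
    by (simp add: has_field_derivative_iff algebra_simps)
  then have "((\<lambda>s. ?g s / s) \<longlongrightarrow> ?k) (at_right 0)"
    by (rule tendsto_within_subset) simp
  then have "\<forall>\<^sub>F s in at_right 0. ?g s / s > ?k / 2"
    by (rule order_tendstoD) (use assms in linarith)
  then show "\<forall>\<^sub>F s in at_right 0. ?g s \<ge> ?k / 2 * s"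
    using eventually_at_right_less[of 0]
    by eventually_elim (simp add: field_simps)
qed

section \<open>The norm inequality\<close>

text \<open>
  If \<open>F\<close> is the image of \<open>E\<close> under an operator \<open>T\<close> with \<open>T E \<approx> e E\<close>, then \<open>1 + c T\<close> acts on \<open>E\<close>
  almost as multiplication by \<open>1 + c e\<close>; the last summand is the price of the approximation.
\<close>

lemma norm_gap_approximate_eigenvector:
  fixes E F :: L2
  shows "(cmod (1 + lam * e) - cmod (1 + mu * e)) * norm E
      \<le> norm (E + lam *\<^sub>C F) - norm (E + mu *\<^sub>C F) + (cmod lam + cmod mu) * norm (F - e *\<^sub>C E)"
proof -
  have eq: "E + c *\<^sub>C F = (1 + c * e) *\<^sub>C E + c *\<^sub>C (F - e *\<^sub>C E)" for c
    by (simp add: scaleC_add_left scaleC_diff_right scaleC_one scaleC_scaleC)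
  have "norm (E + mu *\<^sub>C F) \<le> cmod (1 + mu * e) * norm E + cmod mu * norm (F - e *\<^sub>C E)"
    unfolding eq[of mu] by (metis norm_scaleC norm_triangle_ineq)
  moreover have "cmod (1 + lam * e) * norm E - cmod lam * norm (F - e *\<^sub>C E) \<le> norm (E + lam *\<^sub>C F)"
    unfolding eq[of lam] by (metis norm_scaleC norm_diff_ineq)
  ultimately show ?thesis by (simp add: algebra_simps)
qed

text \<open>
  With \<open>E = exp_L2 z\<close>, \<open>z = R w\<close> and \<open>e = z\<^bsup>-n\<^esup>\<close>, the approximation error \<open>\<parallel>V\<^sup>n E - e E\<parallel>\<close> stays
  bounded as \<open>R\<close> grows, while the gain \<open>(\<bar>1 + lam e\<bar> - \<bar>1 + mu e\<bar>) \<parallel>E\<parallel>\<close> is at least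
  \<open>k R\<^bsup>-n\<^esup> \<parallel>E\<parallel>\<close> and tends to infinity.
\<close>

lemma exists_norm_increase:
  fixes lam mu :: complex
  assumes "n \<ge> 2" "lam \<noteq> mu"
  shows "\<exists>E. norm (E + lam *\<^sub>C (volterra ^^ n) E) > norm (E + mu *\<^sub>C (volterra ^^ n) E)"
proof -
  obtain w where w: "cmod w = 1" "Re w > 0" "Re ((lam - mu) / w ^ n) > 0"
    using obtain_direction[of n "lam - mu"] assms by auto
  define a where "a = inverse (w ^ n)"
  obtain k where k: "k > 0" and gap: "\<forall>\<^sub>F s in at_right 0.
      cmod (1 + lam * a * complex_of_real s) - cmod (1 + mu * a * complex_of_real s) \<ge> k * s"
    using cmod_affine_gap[of lam mu a] w(3) by (auto simp: a_def divide_inverse)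
  have "filterlim (\<lambda>R::real. inverse (R ^ n)) (at_right 0) at_top"
    using assms by (intro filterlim_compose[OF filterlim_inverse_at_right_top] filterlim_pow_at_top filterlim_ident) auto
  note gap' = eventually_compose_filterlim[OF gap this]
  have "\<forall>\<^sub>F R in at_top. (exp (Re w * R) - 1) / (Re w * R) / R ^ n > (cmod lam + cmod mu) * n / k"
    using exp_quotient_dominates_power[OF w(2), of n] by (simp add: filterlim_at_top_dense)
  with gap' have "\<forall>\<^sub>F R in at_top. 1 \<le> R \<and>
      k * inverse (R ^ n) \<le> cmod (1 + lam * a * complex_of_real (inverse (R ^ n)))
        - cmod (1 + mu * a * complex_of_real (inverse (R ^ n))) \<and>
      (cmod lam + cmod mu) * n / k < (exp (Re w * R) - 1) / (Re w * R) / R ^ n"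
    using eventually_ge_at_top[of 1] by eventually_elim auto
  then obtain R where R: "1 \<le> R"
    and g: "k * inverse (R ^ n) \<le> cmod (1 + lam * a * complex_of_real (inverse (R ^ n)))
        - cmod (1 + mu * a * complex_of_real (inverse (R ^ n)))"
    and big: "(cmod lam + cmod mu) * n / k < (exp (Re w * R) - 1) / (Re w * R) / R ^ n"
    using eventually_happens'[OF trivial_limit_at_top_linorder] by blast
  define z where "z = complex_of_real R * w"
  define e where "e = inverse (z ^ n)"
  define E where "E = exp_L2 z"
  let ?F = "(volterra ^^ n) E"
  have cz: "cmod z = R" and z0: "z \<noteq> 0" and Rz: "Re z = Re w * R"
    using w R by (auto simp: z_def norm_mult)
  have e_a: "e = a * complex_of_real (inverse (R ^ n))"
    by (simp add: e_def a_def z_def power_mult_distrib)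
  have ce: "cmod e = inverse (R ^ n)"
    using cz by (simp add: e_def norm_inverse norm_power)
  \<comment> \<open>The true order is \<open>R ^ (n - 1)\<close>; any power of \<open>R\<close> loses against the exponential growth of \<open>\<parallel>E\<parallel>\<close>.\<close>
  have "(\<Sum>j<n. R ^ j) \<le> (\<Sum>j<n. R ^ n)"
    using R by (intro sum_mono power_increasing) auto
  with norm_volterra_funpow_exp_L2_remainder[of z n]
  have rem: "norm (z ^ n *\<^sub>C ?F - E) \<le> n * R ^ n"
    by (simp add: cz E_def)
  have "?F - e *\<^sub>C E = e *\<^sub>C (z ^ n *\<^sub>C ?F - E)"
    using z0 by (simp add: scaleC_diff_right scaleC_scaleC e_def scaleC_one)
  then have "norm (?F - e *\<^sub>C E) = inverse (R ^ n) * norm (z ^ n *\<^sub>C ?F - E)"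
    by (simp add: norm_scaleC ce)
  also have "\<dots> \<le> inverse (R ^ n) * (n * R ^ n)"
    using rem R by (intro mult_left_mono) auto
  also have "\<dots> = n"
    using R by simp
  finally have "(cmod lam + cmod mu) * norm (?F - e *\<^sub>C E) \<le> (cmod lam + cmod mu) * n"
    by (intro mult_left_mono) auto
  also have "\<dots> < k * inverse (R ^ n) * ((exp (Re z) - 1) / Re z)"
    using big k R unfolding Rz by (simp add: field_simps)
  also have "\<dots> \<le> k * inverse (R ^ n) * norm E"
    using norm_exp_L2_ge[of z] k R w unfolding E_def Rz by (intro mult_left_mono) auto
  also have "\<dots> \<le> (cmod (1 + lam * e) - cmod (1 + mu * e)) * norm E"
    using g unfolding e_a by (intro mult_right_mono) (auto simp: mult.assoc)
  finally show ?thesis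
    using norm_gap_approximate_eigenvector[of lam e mu E ?F] by (intro exI[of _ E]) linarith
qed

theorem corollary1p7:
  fixes n :: nat and lam mu :: complex
  assumes "n \<ge> 2" and "lam \<noteq> mu"
  shows "onorm ((\<lambda>f. f + lam *\<^sub>C (volterra ^^ n) f) \<circ> inv (\<lambda>f. f + mu *\<^sub>C (volterra ^^ n) f)) > 1"
proof (rule ccontr)
  let ?A = "\<lambda>f. f + lam *\<^sub>C (volterra ^^ n) f"
  let ?B = "\<lambda>f. f + mu *\<^sub>C (volterra ^^ n) f"
  assume "\<not> onorm (?A \<circ> inv ?B) > 1"
  then have le: "onorm (?A \<circ> inv ?B) \<le> 1" by simp
  have B: "bij ?B" "bounded_linear (inv ?B)"
    using id_plus_volterra_funpow_inverse[of n mu] assms by auto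
  have A: "bounded_linear ?A"
    by (intro bounded_linear_add bounded_linear_ident
        bounded_linear_compose[OF bounded_linear_scaleC bounded_linear_volterra_funpow])
  have bl: "bounded_linear (?A \<circ> inv ?B)"
    unfolding comp_def by (rule bounded_linear_compose[OF A B(2)])
  obtain E where E: "norm (?A E) > norm (?B E)"
    using exists_norm_increase[OF assms] by blast
  have "norm ((?A \<circ> inv ?B) (?B E)) \<le> onorm (?A \<circ> inv ?B) * norm (?B E)"
    by (rule onorm[OF bl])
  also have "\<dots> \<le> 1 * norm (?B E)"
    using le by (intro mult_right_mono) auto
  also have "(?A \<circ> inv ?B) (?B E) = ?A E"
    using inv_f_f[OF bij_is_inj[OF B(1)], of E] by (simp only: comp_def)
  finally show False using E by simp
qed
end
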